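(* Let $w$ and $w'$ be binary words over $\{0,1\}$. Then $L_{\mathrm{RC}(w)}=L_{\mathrm{RC}(w')}$ if and only if $F_1(w,i)=F_1(w',i)$ for all $i\in\mathbb{N}$.
   Context: A caterpillar sequence is a finite sequence $S=(s_1,\dots,s_k)$, $k\ge1$, of non-negative integers with $s_1,s_k\ge 1$, and $s_1\ge 2$ if $k=1$. Its associated caterpillar graph is the tree consisting of a path $v_1,\dots,v_k$ with $s_j$ extra pendant vertices (leaves) attached to $v_j$ for each $j$. For a caterpillar sequence $S$, $L_S$ denotes the leaf function of its associated caterpillar graph, where the leaf function of a finite simple graph $G$ with $n$ vertices is $L_G(i)=\max\{\text{number of degree-1 vertices of }T: T\text{ an induced subtree of }G\text{ with }i\text{ vertices}\}$ for $i=0,\dots,n$ (with $\max\emptyset=-\infty$). The reading caterpillar sequence $\mathrm{RC}(w)$ of a binary word $w$ is defined recursively: $\mathrm{RC}(\varepsilon)=(2)$, and if $\mathrm{RC}(u)=(r_1,\dots,r_k)$ then $\mathrm{RC}(u0)=(r_1,\dots,r_{k-1},r_k-1,1)$ and $\mathrm{RC}(u1)=(r_1,\dots,r_{k-1},r_k+1)$. For a binary word $u$ and $i\in\mathbb{N}$, $F_1(u,i)$ is the maximum number of occurrences of the letter $1$ in a factor (contiguous subword) of $u$ of length $i$. *)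

theory Defs
  imports
    "Graph_Theory.Digraph_Component"
    "HOL-Library.Extended_Real"
    "HOL-Library.Sublist"
begin

text \<open>Maximum of a finite set of naturals, with value \<open>-\<infinity>\<close> on the empty set.\<close>

definition ext_max :: "nat set \<Rightarrow> ereal" where
  "ext_max A = (if A = {} then -\<infinity> else ereal (real (Max A)))"

text \<open>
  A finite simple graph is a symmetric, loop-free digraph without parallel arcs (locale \<open>graph\<close>),
  an undirected edge being a pair of opposite arcs. The library's \<open>tree\<close> is not usable for such
  digraphs: going along an edge and back is a \<open>cycle\<close> of length 2 there. The cycles of the
  underlying undirected graph are those of length at least 3. The empty graph counts as a tree,
  so that the leaf function takes the value 0 at 0.
\<close>

definition undirected_tree :: "('a, 'b) pre_digraph \<Rightarrow> bool" where
  "undirected_tree G \<longleftrightarrow>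
     (verts G = {} \<or> Digraph_Component.connected G) \<and>
     \<not> (\<exists>p. pre_digraph.cycle G p \<and> length p \<ge> 3)"

text \<open>In a symmetric digraph, the degree of a vertex in the undirected sense is its out-degree.\<close>

definition leaves :: "('a, 'b) pre_digraph \<Rightarrow> 'a set" where
  "leaves G = {v \<in> verts G. out_degree G v = 1}"

text \<open>
  The domain \<open>{0..n}\<close> is part of the leaf function, which is therefore a partial map:
  it is undefined (\<open>None\<close>) beyond the number of vertices.
\<close>

definition leaf_function :: "('a, 'b) pre_digraph \<Rightarrow> nat \<rightharpoonup> ereal" where
  "leaf_function G i =
     (if i \<le> card (verts G)
      then Some (ext_max {card (leaves (G \<restriction> X)) | X.
             X \<subseteq> verts G \<and> card X = i \<and> undirected_tree (G \<restriction> X)})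
      else None)"

definition caterpillar_seq :: "nat list \<Rightarrow> bool" where
  "caterpillar_seq s \<longleftrightarrow>
     s \<noteq> [] \<and> hd s \<ge> 1 \<and> last s \<ge> 1 \<and> (length s = 1 \<longrightarrow> hd s \<ge> 2)"

text \<open>Positions are counted from 0; \<open>Pendant j m\<close> is the \<open>m\<close>-th pendant vertex at \<open>Spine j\<close>.\<close>

datatype cat_vertex = Spine nat | Pendant nat nat

definition cat_edges :: "nat list \<Rightarrow> (cat_vertex \<times> cat_vertex) set" where
  "cat_edges s =
     {(Spine j, Spine (Suc j)) | j. Suc j < length s} \<union>
     {(Spine j, Pendant j m) | j m. j < length s \<and> m < s ! j}"

definition caterpillar_graph :: "nat list \<Rightarrow> cat_vertex pair_pre_digraph" where
  "caterpillar_graph s =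
     \<lparr> pverts = {Spine j | j. j < length s} \<union> {Pendant j m | j m. j < length s \<and> m < s ! j},
       parcs = cat_edges s \<union> (cat_edges s)\<inverse> \<rparr>"

lemma pair_graph_caterpillar: "pair_graph (caterpillar_graph s)"
proof -
  have V: "{Spine j | j. j < length s} \<union> {Pendant j m | j m. j < length s \<and> m < s ! j} =
           Spine ` {..<length s} \<union> (\<Union>j\<in>{..<length s}. Pendant j ` {..<s ! j})"
    by auto
  have finV: "finite (pverts (caterpillar_graph s))"
    unfolding caterpillar_graph_def by (simp add: V del: Un_iff)
  have sub: "parcs (caterpillar_graph s) \<subseteq> pverts (caterpillar_graph s) \<times> pverts (caterpillar_graph s)"
    by (auto simp: caterpillar_graph_def cat_edges_def)
  show ?thesis
  proof
    show "finite (parcs (caterpillar_graph s))"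
      using finite_subset[OF sub] finV by blast
    show "symmetric (with_proj (caterpillar_graph s))"
      by (auto simp: symmetric_def arcs_ends_conv sym_def caterpillar_graph_def)
  qed (use finV sub in \<open>auto simp: caterpillar_graph_def cat_edges_def\<close>)
qed

definition cat_leaf_function :: "nat list \<Rightarrow> nat \<rightharpoonup> ereal" where
  "cat_leaf_function s = leaf_function (with_proj (caterpillar_graph s))"

text \<open>A binary word is a \<open>bool list\<close>: \<open>True\<close> is the letter 1 and \<open>False\<close> is the letter 0.\<close>

definition RC_step :: "nat list \<Rightarrow> bool \<Rightarrow> nat list" where
  "RC_step r b = butlast r @ (if b then [last r + 1] else [last r - 1, 1])"

definition RC :: "bool list \<Rightarrow> nat list" where
  "RC w = foldl RC_step [2] w"

lemma RC_simps:
  "RC [] = [2]"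
  "RC (u @ [False]) = butlast (RC u) @ [last (RC u) - 1, 1]"
  "RC (u @ [True]) = butlast (RC u) @ [last (RC u) + 1]"
  by (simp_all add: RC_def RC_step_def)

text \<open>In particular the subtraction \<open>last r - 1\<close> is never truncated.\<close>

lemma caterpillar_seq_RC: "caterpillar_seq (RC w)"
proof (induction w rule: rev_induct)
  case Nil
  show ?case by (simp add: RC_simps caterpillar_seq_def)
next
  case (snoc b u)
  then obtain r x where r: "RC u = r @ [x]"
    unfolding caterpillar_seq_def by (metis append_butlast_last_id)
  then show ?case
    using snoc by (cases b; cases r) (auto simp: RC_simps caterpillar_seq_def)
qed

definition F1 :: "bool list \<Rightarrow> nat \<Rightarrow> ereal" where
  "F1 u i = ext_max {count_list v True | v. sublist v u \<and> length v = i}"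

end

theory Submission
  imports Defs
begin

text \<open>
  For \<open>i \<le> |w|\<close> the leaf function satisfies \<open>L(i + 3) = F\<^sub>1(w, i) + 2\<close>, while \<open>L(0) = L(1) = 0\<close> and
  \<open>L(2) = 2\<close> for every word; moreover the graph has \<open>|w| + 3\<close> vertices. To see this, write \<open>w\<close> as runs
  of 1s separated by 0s: \<open>RC w\<close> is the list of run lengths, with the first and the last one
  increased by 1. The inner vertices of an induced subtree with at least 3 vertices form a segment
  \<open>c..d\<close> of the spine and its leaves are among the other neighbours of that segment, any set of which can
  conversely be attached to the segment as leaves.
  Whatever the position of the segment, these neighbours are 2 more than the 1s in the
  runs \<open>c..d\<close> of \<open>w\<close>: an end of the segment either has a further spine neighbour or carries the
  additional pendant vertex. The factor of \<open>w\<close> consisting of these runs contains \<open>d - c\<close> zeros, so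
  choosing a subtree amounts to choosing a factor.
\<close>

section \<open>Runs of 1s\<close>

text \<open>The lengths of the maximal, possibly empty, runs of 1s delimited by the 0s.\<close>

fun blocks :: "bool list \<Rightarrow> nat list" where
  "blocks [] = [0]"
| "blocks (True # w) = Suc (hd (blocks w)) # tl (blocks w)"
| "blocks (False # w) = 0 # blocks w"

text \<open>The inverse of \<open>blocks\<close>. No word has the empty list of runs; its value here
  is that of \<open>[0]\<close>, hence the nonemptiness assumptions in the append law.\<close>

fun of_blocks :: "nat list \<Rightarrow> bool list" where
  "of_blocks [] = []"
| "of_blocks [n] = replicate n True"
| "of_blocks (n # m # ns) = replicate n True @ False # of_blocks (m # ns)"

lemma blocks_nonempty [simp]: "blocks w \<noteq> []"
  by (induction w rule: blocks.induct) auto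

lemma length_blocks: "length (blocks w) = Suc (count_list w False)"
  by (induction w rule: blocks.induct) (auto simp: Suc_le_eq)

lemma sum_list_blocks: "sum_list (blocks w) = count_list w True"
proof (induction w rule: blocks.induct)
  case (2 w)
  then show ?case by (cases "blocks w") auto
qed auto

lemma length_eq_counts: "length w = count_list w True + count_list w False"
  by (induction w) auto

lemma of_blocks_Suc: "of_blocks (Suc n # ns) = True # of_blocks (n # ns)"
  by (cases ns) auto

lemma of_blocks_blocks [simp]: "of_blocks (blocks w) = w"
proof (induction w rule: blocks.induct)
  case (2 w)
  then show ?case by (cases "blocks w") (auto simp: of_blocks_Suc)
next
  case (3 w)
  then show ?case by (cases "blocks w") auto
qed auto

lemma of_blocks_append:
  assumes "xs \<noteq> []" "ys \<noteq> []"
  shows "of_blocks (xs @ ys) = of_blocks xs @ False # of_blocks ys"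
  using assms
proof (induction xs rule: of_blocks.induct)
  case (2 n)
  then show ?case by (cases ys) auto
qed auto

lemma count_list_replicate: "count_list (replicate n x) y = (if x = y then n else 0)"
  by (induction n) auto

lemma count_of_blocks:
  "count_list (of_blocks ns) True = sum_list ns"
  "count_list (of_blocks ns) False = length ns - 1"
  by (induction ns rule: of_blocks.induct) (auto simp: count_list_replicate)

section \<open>Factors of a word and segments of its list of runs\<close>

lemma sublist_of_blocks:
  assumes "sublist ys xs" "ys \<noteq> []"
  shows "sublist (of_blocks ys) (of_blocks xs)"
proof -
  from assms(1) obtain as bs where xs: "xs = as @ ys @ bs"
    by (auto simp: sublist_def)
  have 1: "sublist (of_blocks ys) (of_blocks (ys @ bs))"
    using assms(2) by (cases "bs = []") (auto simp: of_blocks_append)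
  have "sublist (of_blocks (ys @ bs)) (of_blocks (as @ ys @ bs))"
    using assms(2) sublist_appendI [of "of_blocks (ys @ bs)" "of_blocks as @ [False]" "[]"]
    by (cases "as = []") (auto simp: of_blocks_append)
  with 1 show ?thesis
    unfolding xs by (rule sublist_order.order_trans)
qed

text \<open>No 0 separates \<open>u\<close> from \<open>v\<close>, so the last run of
  \<open>u\<close> and the first run of \<open>v\<close> merge.\<close>

lemma blocks_append:
  "blocks (u @ v) = butlast (blocks u) @ [last (blocks u) + hd (blocks v)] @ tl (blocks v)"
proof (induction u rule: blocks.induct)
  case (2 u)
  then show ?case by (cases "blocks u") auto
qed auto

lemma blocks_append_nth:
  shows "j < count_list u False \<Longrightarrow> blocks (u @ v) ! j = blocks u ! j"
    and "blocks (u @ v) ! (count_list u False + j) =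
      (if j = 0 then last (blocks u) else 0) + blocks v ! j"
  by (cases "blocks v"; auto simp: blocks_append nth_append length_blocks nth_butlast)+

lemma sum_blocks_segment:
  assumes "c \<le> d" "d < length (blocks w)"
  shows "sum_list (take (Suc (d - c)) (drop c (blocks w))) = (\<Sum>j=c..d. blocks w ! j)"
proof -
  let ?xs = "take (Suc (d - c)) (drop c (blocks w))"
  have l: "length ?xs = Suc (d - c)"
    using assms by auto
  have "sum_list ?xs = (\<Sum>j=0..<Suc (d - c). ?xs ! j)"
    unfolding sum_list_sum_nth l ..
  also have "\<dots> = (\<Sum>j=0..<Suc (d - c). blocks w ! (j + c))"
    by (intro sum.cong) (use assms in \<open>auto simp: add.commute\<close>)
  also have "\<dots> = (\<Sum>j=0+c..<Suc (d - c)+c. blocks w ! j)"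
    by (rule sum.shift_bounds_nat_ivl [symmetric])
  also have "\<dots> = (\<Sum>j=c..d. blocks w ! j)"
    using assms by (intro sum.cong) auto
  finally show ?thesis .
qed

text \<open>The runs \<open>c..d\<close> with the 0s between them spell a factor with exactly
  \<open>d - c\<close> zeros, and cutting it down to length \<open>i\<close> cannot create
  zeros.\<close>

lemma factor_of_segment:
  assumes "c \<le> d" "d < length (blocks w)" "i \<le> (\<Sum>j=c..d. blocks w ! j) + (d - c)"
  shows "\<exists>v. sublist v w \<and> length v = i \<and> i \<le> count_list v True + (d - c)"
proof -
  define xs where "xs = take (Suc (d - c)) (drop c (blocks w))"
  have l: "length xs = Suc (d - c)"
    using assms by (auto simp: xs_def)
  have "sublist xs (blocks w)"
    unfolding xs_def by (meson sublist_drop sublist_order.order_trans sublist_take)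
  then have "sublist (of_blocks xs) (of_blocks (blocks w))"
    using l by (intro sublist_of_blocks) auto
  then have "sublist (of_blocks xs) w"
    by simp
  then have sub: "sublist (take i (of_blocks xs)) w"
    by (meson sublist_order.order_trans sublist_take)
  have "i \<le> length (of_blocks xs)"
    using assms l by (simp add: length_eq_counts count_of_blocks sum_blocks_segment xs_def)
  then have len: "length (take i (of_blocks xs)) = i"
    by simp
  have "count_list (of_blocks xs) False =
      count_list (take i (of_blocks xs)) False + count_list (drop i (of_blocks xs)) False"
    by (metis append_take_drop_id count_list_append)
  then have "count_list (take i (of_blocks xs)) False \<le> d - c"
    using l by (simp add: count_of_blocks)
  then have "i \<le> count_list (take i (of_blocks xs)) True + (d - c)"
    using len length_eq_counts [of "take i (of_blocks xs)"] by simp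
  with sub len show ?thesis
    by blast
qed

text \<open>The zeros before the factor tell the run \<open>c\<close> in which it starts, and its
  own zeros tell how many further runs it meets. Only an inequality results, since the factor may
  cut off parts of the first and the last of these runs.\<close>

lemma segment_of_factor:
  assumes "sublist v w"
  shows "\<exists>c d. c \<le> d \<and> d < length (blocks w) \<and> d - c = count_list v False \<and>
    count_list v True \<le> (\<Sum>j=c..d. blocks w ! j)"
proof -
  from assms obtain p q where w: "w = p @ v @ q"
    by (auto simp: sublist_def)
  define c where "c = count_list p False"
  define z where "z = count_list v False"
  \<comment> \<open>Each run of \<open>v\<close> lies within the run of \<open>w\<close> whose index
    is shifted by the zeros of \<open>p\<close>. Appending \<open>q\<close> can lengthen only the
    last run of \<open>v\<close>, prepending \<open>p\<close> only the first.\<close>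
  have "blocks v ! j \<le> blocks w ! (c + j)" if "j < Suc z" for j
  proof -
    have "blocks v ! j \<le> blocks (v @ q) ! j"
    proof (cases "j < z")
      case True
      then show ?thesis by (simp add: blocks_append_nth z_def)
    next
      case False
      with that have "j = z" by simp
      then show ?thesis
        using blocks_append_nth(2) [of v q 0]
        by (simp add: z_def last_conv_nth length_blocks)
    qed
    also have "\<dots> \<le> blocks w ! (c + j)"
      by (simp add: w c_def blocks_append_nth)
    finally show ?thesis .
  qed
  then have "(\<Sum>j=0..<Suc z. blocks v ! j) \<le> (\<Sum>j=0..<Suc z. blocks w ! (j + c))"
    by (intro sum_mono) (auto simp: add.commute)
  also have "\<dots> = (\<Sum>j=0+c..<Suc z+c. blocks w ! j)"
    by (rule sum.shift_bounds_nat_ivl [symmetric])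
  also have "\<dots> = (\<Sum>j=c..c+z. blocks w ! j)"
    by (intro sum.cong) auto
  finally have "count_list v True \<le> (\<Sum>j=c..c+z. blocks w ! j)"
    by (simp add: z_def length_blocks sum_list_sum_nth flip: sum_list_blocks)
  moreover have "c + z < length (blocks w)"
    by (simp add: w length_blocks c_def z_def)
  ultimately show ?thesis
    by (intro exI [of _ c] exI [of _ "c + z"]) (simp add: z_def)
qed

text \<open>Reading a 0 moves the surplus 1 at the end from the old last run to the new one, which
  explains the entries \<open>last r - 1\<close> and \<open>1\<close> in \<open>RC_step\<close>. If
  there is only one run, it receives both surpluses, as in \<open>RC [] = [2]\<close>.\<close>

lemma RC_eq_blocks:
  "length (RC w) = length (blocks w) \<and>
   (\<forall>j<length (blocks w). RC w ! j = blocks w ! j + of_bool (j = 0) + of_bool (Suc j = length (blocks w)))"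
proof (induction w rule: rev_induct)
  case Nil
  then show ?case by (simp add: RC_simps)
next
  case (snoc b u)
  obtain r x where r: "RC u = r @ [x]"
    using caterpillar_seq_RC [of u] unfolding caterpillar_seq_def
    by (metis append_butlast_last_id)
  obtain s y where s: "blocks u = s @ [y]"
    using blocks_nonempty by (metis append_butlast_last_id)
  from snoc r s have l: "length r = length s"
    by simp
  have x: "x = y + of_bool (s = []) + 1"
    using snoc r s l by (auto simp: nth_append dest: spec [of _ "length s"])
  have rs: "r ! j = s ! j + of_bool (j = 0)" if "j < length s" for j
    using snoc r s l that by (auto simp: nth_append dest: spec [of _ "j"])
  show ?case
    using l x rs
    by (cases b) (auto simp: RC_simps blocks_append r s nth_append nth_Cons' less_Suc_eq)
qed

section \<open>Induced subtrees of caterpillars\<close>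

abbreviation caterpillar :: "nat list \<Rightarrow> (cat_vertex, cat_vertex \<times> cat_vertex) pre_digraph" where
  "caterpillar s \<equiv> with_proj (caterpillar_graph s)"

abbreviation adj :: "nat list \<Rightarrow> cat_vertex rel" where
  "adj s \<equiv> parcs (caterpillar_graph s)"

lemma adj_sym: "(u, v) \<in> adj s \<longleftrightarrow> (v, u) \<in> adj s"
  by (auto simp: caterpillar_graph_def)

lemma adj_simps:
  "(Spine j, Spine k) \<in> adj s \<longleftrightarrow> (k = Suc j \<and> k < length s) \<or> (j = Suc k \<and> j < length s)"
  "(Spine j, Pendant k m) \<in> adj s \<longleftrightarrow> k = j \<and> j < length s \<and> m < s ! j"
  "(Pendant k m, Spine j) \<in> adj s \<longleftrightarrow> k = j \<and> j < length s \<and> m < s ! j"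
  "(Pendant k m, Pendant j n) \<notin> adj s"
  by (auto simp: caterpillar_graph_def cat_edges_def)

lemma finite_pverts [simp]: "finite (pverts (caterpillar_graph s))"
  using pair_graph_caterpillar
  by (simp add: pair_graph_def pair_digraph_def pair_fin_digraph_def pair_fin_digraph_axioms_def)

lemma pverts_simps:
  "Spine j \<in> pverts (caterpillar_graph s) \<longleftrightarrow> j < length s"
  "Pendant j m \<in> pverts (caterpillar_graph s) \<longleftrightarrow> j < length s \<and> m < s ! j"
  by (auto simp: caterpillar_graph_def)

section \<open>Leaves, connectedness and acyclicity of induced subgraphs\<close>

lemma leaves_induce:
  "leaves (caterpillar s \<restriction> X) = {v \<in> X. card {u \<in> X. (v, u) \<in> adj s} = 1}"
proof -
  have "out_degree (caterpillar s \<restriction> X) v = card {u \<in> X. (v, u) \<in> adj s}" if "v \<in> X" for v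
  proof -
    have "out_arcs (caterpillar s \<restriction> X) v = Pair v ` {u \<in> X. (v, u) \<in> adj s}"
      using that by auto
    then show ?thesis
      by (simp add: out_degree_def card_image inj_on_def)
  qed
  then show ?thesis
    by (auto simp: leaves_def)
qed

lemma connected_induce:
  "Digraph_Component.connected (caterpillar s \<restriction> X) \<longleftrightarrow>
     X \<noteq> {} \<and> (\<forall>u\<in>X. \<forall>v\<in>X. (u, v) \<in> rtrancl_on X (adj s \<inter> X \<times> X))"
proof -
  have "(arcs_ends (caterpillar s \<restriction> X))\<^sup>s = adj s \<inter> X \<times> X"
    using adj_sym by (fastforce simp: arcs_ends_conv symcl_def)
  then show ?thesis
    by (simp add: connected_conv)
qed

text \<open>If no edge left \<open>Y\<close>, a path starting in \<open>a\<close> could never reach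
  \<open>b\<close>.\<close>

lemma connected_cut:
  assumes "Digraph_Component.connected (caterpillar s \<restriction> X)" "Y \<subseteq> X" "a \<in> Y" "b \<in> X" "b \<notin> Y"
  shows "\<exists>u\<in>Y. \<exists>v\<in>X - Y. (u, v) \<in> adj s"
proof (rule ccontr)
  assume *: "\<not> ?thesis"
  have "(a, b) \<in> rtrancl_on X (adj s \<inter> X \<times> X)"
    using assms by (auto simp: connected_induce)
  then have "b \<in> Y"
    by (induction rule: rtrancl_on_induct) (use assms * in auto)
  with assms show False
    by simp
qed

lemma connectedI:
  assumes "r \<in> X" "\<And>v. v \<in> X \<Longrightarrow> (r, v) \<in> rtrancl_on X (adj s \<inter> X \<times> X)"
  shows "Digraph_Component.connected (caterpillar s \<restriction> X)"
proof -
  have "sym (adj s \<inter> X \<times> X)"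
    using adj_sym by (auto simp: sym_def)
  then have "(v, r) \<in> rtrancl_on X (adj s \<inter> X \<times> X)" if "v \<in> X" for v
    using assms(2) [OF that] rtrancl_on_sym by (metis symE)
  with assms show ?thesis
    unfolding connected_induce by (meson empty_iff rtrancl_on_trans)
qed

text \<open>The distance from \<open>Spine 0\<close>, taken as the root: each edge joins different
  depths, and each vertex has at most one shallower neighbour.\<close>

fun depth :: "cat_vertex \<Rightarrow> nat" where
  "depth (Spine j) = j"
| "depth (Pendant j m) = Suc j"

lemma adj_depth:
  assumes "(u, v) \<in> adj s"
  shows "depth u \<noteq> depth v"
  using assms by (cases u; cases v) (auto simp: adj_simps)

lemma adj_parent_unique:
  assumes "(u, v) \<in> adj s" "(u, v') \<in> adj s" "depth v < depth u" "depth v' < depth u"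
  shows "v = v'"
  using assms by (cases u; cases v; cases v') (auto simp: adj_simps)

text \<open>The two neighbours on a cycle of a deepest vertex would both be its parent.\<close>

lemma no_cycle:
  assumes "pre_digraph.cycle (caterpillar s \<restriction> X) p" "length p \<ge> 3"
  shows False
proof -
  interpret wf_digraph "caterpillar s \<restriction> X"
    by unfold_locales auto
  from assms(1) obtain u where u: "awalk u p u" "distinct (tl (awalk_verts u p))" "p \<noteq> []"
    by (auto simp: cycle_def)
  define f where "f i = awalk_verts u p ! i" for i
  define n where "n = length p"
  have "f 0 = u" "f n = u"
    using u by (auto simp: f_def n_def length_awalk_verts hd_conv_nth last_conv_nth elim!: awalkE)
  then have ends: "f 0 = f n"
    by simp
  have edge: "(f i, f (Suc i)) \<in> adj s" if "i < n" for i
  proof -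
    have "f i = fst (p ! i)"
      using that u(3) by (simp add: f_def n_def awalk_verts_conv nth_append)
    moreover have "f (Suc i) = snd (p ! i)"
      using that u by (auto simp: f_def n_def awalk_verts_conv' elim!: awalkE)
    moreover have "p ! i \<in> adj s"
      using that u(1) nth_mem [of i p] by (auto simp: n_def simp del: nth_mem elim!: awalkE)
    ultimately show ?thesis by simp
  qed
  have inj: "i = j" if "f i = f j" "1 \<le> i" "i \<le> n" "1 \<le> j" "j \<le> n" for i j
  proof -
    have "tl (awalk_verts u p) ! (i - 1) = f i" "tl (awalk_verts u p) ! (j - 1) = f j"
      using that by (auto simp: f_def nth_tl n_def length_awalk_verts)
    then have "i - 1 = j - 1"
      using that u(2) by (subst nth_eq_iff_index_eq [OF u(2), symmetric])
        (auto simp: length_awalk_verts n_def)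
    with that show ?thesis by simp
  qed
  have n: "n \<ge> 3"
    using assms(2) by (simp add: n_def)
  obtain i where i: "i \<in> {1..n}" and max: "\<And>j. j \<in> {1..n} \<Longrightarrow> depth (f j) \<le> depth (f i)"
  proof -
    have "Max ((depth \<circ> f) ` {1..n}) \<in> (depth \<circ> f) ` {1..n}"
      using n by (intro Max_in) auto
    then obtain i where "i \<in> {1..n}" "depth (f i) = Max ((depth \<circ> f) ` {1..n})"
      by auto
    then show thesis
      by (intro that [of i]) (auto intro!: Max_ge)
  qed
  have max0: "depth (f j) \<le> depth (f i)" if "j \<le> n" for j
    using max [of j] max [of n] that ends n by (cases "j = 0") auto
  \<comment> \<open>The indices of the predecessor and the successor of the deepest vertex on the
    cycle; as \<open>f 0 = f n\<close>, the successor of \<open>n\<close> is 1.\<close>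
  define a where "a = i - 1"
  define b where "b = (if i = n then 1 else Suc i)"
  have a: "(f i, f a) \<in> adj s" "a \<le> n"
    using edge [of a] i adj_sym by (auto simp: a_def)
  have b: "(f i, f b) \<in> adj s" "b \<le> n"
    using edge [of i] edge [of 0] i ends n by (auto simp: b_def)
  have "depth (f a) < depth (f i)" "depth (f b) < depth (f i)"
    using adj_depth [OF a(1)] adj_depth [OF b(1)] max0 [OF a(2)] max0 [OF b(2)] by auto
  then have "f a = f b"
    by (rule adj_parent_unique [OF a(1) b(1)])
  \<comment> \<open>Injectivity is available on \<open>1..n\<close> only, so index 0 is replaced by
    \<open>n\<close>. The two indices then differ because the cycle has length at least 3.\<close>
  moreover have "f a = f (if a = 0 then n else a)"
    using ends by simp
  ultimately have "(if a = 0 then n else a) = b"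
    using a b n i by (intro inj) (auto simp: b_def)
  then show False
    using i n by (auto simp: a_def b_def split: if_splits)
qed

lemma undirected_tree_induce:
  "undirected_tree (caterpillar s \<restriction> X) \<longleftrightarrow>
     X = {} \<or> Digraph_Component.connected (caterpillar s \<restriction> X)"
  using no_cycle by (auto simp: undirected_tree_def)

section \<open>Spine segments and the subtrees grown from them\<close>

text \<open>The vertices outside the spine segment from \<open>c\<close> to \<open>d\<close> that are adjacent to it.\<close>

definition outer :: "nat list \<Rightarrow> nat \<Rightarrow> nat \<Rightarrow> cat_vertex set" where
  "outer s c d = (\<Union>j\<in>{c..d}. Pendant j ` {..<s ! j}) \<union>
     {Spine j | j. Suc j = c} \<union> {Spine j | j. j = Suc d \<and> j < length s}"

lemma card_outer:
  assumes "c \<le> d"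
  shows "card (outer s c d) = (\<Sum>j=c..d. s ! j) + of_bool (c > 0) + of_bool (Suc d < length s)"
proof -
  define P where "P = (\<Union>j\<in>{c..d}. Pendant j ` {..<s ! j})"
  have "card P = (\<Sum>j=c..d. card (Pendant j ` {..<s ! j}))"
    unfolding P_def by (rule card_UN_disjoint) auto
  also have "\<dots> = (\<Sum>j=c..d. s ! j)"
    by (intro sum.cong) (auto simp: card_image inj_on_def)
  finally have P: "card P = (\<Sum>j=c..d. s ! j)" "finite P" "\<And>k. Spine k \<notin> P"
    by (auto simp: P_def)
  have "outer s c d = P \<union> (if c > 0 then {Spine (c - 1)} else {}) \<union>
      (if Suc d < length s then {Spine (Suc d)} else {})"
    by (auto simp: outer_def P_def)
  with P assms show ?thesis
    by auto
qed

lemma finite_outer [simp]: "finite (outer s c d)"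
proof -
  have "{Spine j | j. Suc j = c} \<subseteq> Spine ` {..c}"
    "{Spine j | j. j = Suc d \<and> j < length s} \<subseteq> Spine ` {..Suc d}"
    by auto
  then show ?thesis
    unfolding outer_def by (auto intro: finite_subset)
qed

lemma outer_disjoint: "outer s c d \<inter> Spine ` {c..d} = {}"
  by (auto simp: outer_def)

lemma adj_segment:
  assumes "(Spine j, v) \<in> adj s" "c \<le> j" "j \<le> d"
  shows "v \<in> Spine ` {c..d} \<union> outer s c d"
  using assms by (cases v) (auto simp: adj_simps outer_def)

text \<open>Outer vertices are pairwise non-adjacent and each touches the segment exactly once.
  Hence those that are attached to the segment become leaves, whichever others are attached.\<close>

lemma adj_outer:
  assumes "v \<in> outer s c d" "c \<le> d" "d < length s"
  obtains j where "c \<le> j" "j \<le> d" "{u \<in> Spine ` {c..d} \<union> outer s c d. (v, u) \<in> adj s} = {Spine j}"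
proof -
  have "\<exists>j. c \<le> j \<and> j \<le> d \<and> {u \<in> Spine ` {c..d} \<union> outer s c d. (v, u) \<in> adj s} = {Spine j}"
  proof (cases v)
    case (Pendant j m)
    with assms show ?thesis
      by (intro exI [of _ j]) (auto simp: adj_simps outer_def)
  next
    case (Spine k)
    with assms have "k = Suc d \<and> k < length s \<or> Suc k = c"
      by (auto simp: outer_def)
    then show ?thesis
    proof
      assume "k = Suc d \<and> k < length s"
      with assms Spine show ?thesis
        by (intro exI [of _ d]) (auto simp: adj_simps outer_def)
    next
      assume "Suc k = c"
      with assms Spine show ?thesis
        by (intro exI [of _ c]) (auto simp: adj_simps outer_def)
    qed
  qed
  with that show thesis by blast
qed

text \<open>The last claim is only an inclusion: if too little is attached, an end of the segment
  can itself be a leaf.\<close>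

lemma segment_tree:
  assumes "c \<le> d" "d < length s" "L \<subseteq> outer s c d"
  defines "X \<equiv> Spine ` {c..d} \<union> L"
  shows "X \<subseteq> pverts (caterpillar_graph s)" "card X = Suc (d - c) + card L"
    "undirected_tree (caterpillar s \<restriction> X)" "L \<subseteq> leaves (caterpillar s \<restriction> X)"
proof -
  show "X \<subseteq> pverts (caterpillar_graph s)"
    using assms by (auto simp: X_def outer_def pverts_simps)
  have "finite L" "Spine ` {c..d} \<inter> L = {}"
    using assms outer_disjoint [of s c d] by (auto intro: finite_subset)
  then have "card X = card (Spine ` {c..d}) + card L"
    by (simp add: X_def card_Un_disjoint)
  then show "card X = Suc (d - c) + card L"
    using assms by (simp add: card_image inj_on_def)
  have nbr: "\<exists>j. c \<le> j \<and> j \<le> d \<and> {u \<in> X. (v, u) \<in> adj s} = {Spine j}" if v: "v \<in> L" for v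
  proof -
    from v assms obtain j where j: "c \<le> j" "j \<le> d"
      "{u \<in> Spine ` {c..d} \<union> outer s c d. (v, u) \<in> adj s} = {Spine j}"
      using adj_outer by blast
    moreover have "X \<subseteq> Spine ` {c..d} \<union> outer s c d" "Spine j \<in> X"
      using assms j by auto
    ultimately have "{u \<in> X. (v, u) \<in> adj s} = {Spine j}"
      by blast
    with j show ?thesis by blast
  qed
  then show "L \<subseteq> leaves (caterpillar s \<restriction> X)"
    by (fastforce simp: leaves_induce X_def)
  have spine: "(Spine c, Spine (c + j)) \<in> rtrancl_on X (adj s \<inter> X \<times> X)" if "c + j \<le> d" for j
    using that
  proof (induction j)
    case 0
    then show ?case by (simp add: X_def)
  next
    case (Suc j)
    then have "(Spine (c + j), Spine (c + Suc j)) \<in> adj s \<inter> X \<times> X"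
      using assms by (auto simp: adj_simps X_def)
    with Suc show ?case
      by (auto intro: rtrancl_on_into_rtrancl_on simp: X_def)
  qed
  have "Digraph_Component.connected (caterpillar s \<restriction> X)"
  proof (rule connectedI [where r = "Spine c"])
    show "Spine c \<in> X"
      using assms by (auto simp: X_def)
    fix v
    assume "v \<in> X"
    then consider j where "v = Spine j" "c \<le> j" "j \<le> d" | "v \<in> L"
      by (auto simp: X_def)
    then show "(Spine c, v) \<in> rtrancl_on X (adj s \<inter> X \<times> X)"
    proof cases
      case 1
      then show ?thesis using spine [of "j - c"] by simp
    next
      case 2
      then obtain j where j: "c \<le> j" "j \<le> d" "{u \<in> X. (v, u) \<in> adj s} = {Spine j}"
        using nbr by blast
      then have "(Spine c, Spine j) \<in> rtrancl_on X (adj s \<inter> X \<times> X)"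
        using spine [of "j - c"] by simp
      moreover have "(Spine j, v) \<in> adj s \<inter> X \<times> X"
        using j adj_sym \<open>v \<in> X\<close> by blast
      ultimately show ?thesis
        using \<open>v \<in> X\<close> by (meson rtrancl_on_into_rtrancl_on)
    qed
  qed
  then show "undirected_tree (caterpillar s \<restriction> X)"
    by (simp add: undirected_tree_induce)
qed

section \<open>From a subtree back to its spine segment\<close>

text \<open>The spine position to which a vertex belongs. The only edge between positions below
  \<open>j\<close> and positions from \<open>j\<close> on is the spine edge from
  \<open>j - 1\<close> to \<open>j\<close>.\<close>

fun spine_index :: "cat_vertex \<Rightarrow> nat" where
  "spine_index (Spine j) = j"
| "spine_index (Pendant j m) = j"

lemma card_nbrs_ge_1:
  assumes "X \<subseteq> pverts (caterpillar_graph s)" "Digraph_Component.connected (caterpillar s \<restriction> X)"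
    "card X \<ge> 2" "v \<in> X"
  shows "card {u \<in> X. (v, u) \<in> adj s} \<ge> 1"
proof -
  have fin: "finite X"
    using assms(1) finite_pverts finite_subset by blast
  have "\<not> X \<subseteq> {v}"
    using assms(3) card_mono [of "{v}" X] by auto
  then obtain b where "b \<in> X" "b \<noteq> v"
    by blast
  then have "\<exists>u\<in>X. (v, u) \<in> adj s"
    using connected_cut [OF assms(2), of "{v}" v b] assms(4) by auto
  then show ?thesis
    using fin by (auto simp: Suc_le_eq card_gt_0_iff)
qed

text \<open>The segment consists of the non-leaves: these have two neighbours, so they are no
  pendant vertices, and connectedness leaves no gaps between them.\<close>

lemma tree_segment:
  assumes X: "X \<subseteq> pverts (caterpillar_graph s)"
    and conn: "Digraph_Component.connected (caterpillar s \<restriction> X)"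
    and card: "card X \<ge> 3"
  shows "\<exists>c d. c \<le> d \<and> d < length s \<and> card X = card (leaves (caterpillar s \<restriction> X)) + Suc (d - c) \<and>
    leaves (caterpillar s \<restriction> X) \<subseteq> outer s c d"
proof -
  define nb where "nb v = {u \<in> X. (v, u) \<in> adj s}" for v
  define L where "L = leaves (caterpillar s \<restriction> X)"
  define I where "I = X - L"
  have fin: "finite X"
    using X finite_pverts finite_subset by blast
  then have fin_nb: "finite (nb v)" for v
    by (simp add: nb_def)
  have L: "L = {v \<in> X. card (nb v) = 1}"
    by (simp add: L_def leaves_induce nb_def)
  have I_iff: "v \<in> I \<longleftrightarrow> v \<in> X \<and> card (nb v) \<ge> 2" for v
    using card_nbrs_ge_1 [OF X conn, of v] card by (fastforce simp: I_def L nb_def)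
  have I_spine: "\<exists>j. v = Spine j \<and> j < length s" if v: "v \<in> I" for v
  proof (cases v)
    case (Spine j)
    with v X show ?thesis by (auto simp: I_def pverts_simps)
  next
    case (Pendant j m)
    have "nb v \<subseteq> {Spine j}"
    proof
      fix u assume "u \<in> nb v"
      then show "u \<in> {Spine j}"
        using Pendant by (cases u) (auto simp: nb_def adj_simps)
    qed
    then have "card (nb v) \<le> 1"
      using card_mono [of "{Spine j}"] by auto
    with v show ?thesis by (simp add: I_iff)
  qed
  have leaf_nbr: "\<exists>y\<in>I. (v, y) \<in> adj s" if v: "v \<in> L" for v
  proof -
    from v obtain y where y: "nb v = {y}"
      by (auto simp: L card_1_singleton_iff)
    then have y': "y \<in> X" "(v, y) \<in> adj s" "v \<in> nb y"
      using v adj_sym by (auto simp: nb_def L)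
    have "y \<in> I"
    \<comment> \<open>Two adjacent leaves would form a whole component, but \<open>X\<close> has a
      third vertex.\<close>
    proof (rule ccontr)
      assume "y \<notin> I"
      then obtain z where "nb y = {z}"
        using y' by (auto simp: I_def L card_1_singleton_iff)
      then have "nb y = {v}"
        using y' by auto
      have "\<not> X \<subseteq> {v, y}"
        using card card_mono [of "{v, y}" X] card_insert_le_m1 [of 2 "{y}" v] by auto
      then obtain b where "b \<in> X" "b \<notin> {v, y}"
        by blast
      then obtain p q where "p \<in> {v, y}" "q \<in> X - {v, y}" "(p, q) \<in> adj s"
        using connected_cut [OF conn, of "{v, y}" v b] y' v by (auto simp: L)
      then show False
        using y \<open>nb y = {v}\<close> by (auto simp: nb_def)
    qed
    with y' show ?thesis by blast
  qed
  define J where "J = {j. Spine j \<in> I}"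
  have IJ: "I = Spine ` J"
    using I_spine by (auto simp: J_def)
  have "X \<noteq> {}"
    using card by auto
  then have "I \<noteq> {}"
    using leaf_nbr by (auto simp: I_def)
  then have "J \<noteq> {}"
    by (simp add: IJ)
  have J_len: "j < length s" if "j \<in> J" for j
    using I_spine that by (auto simp: J_def)
  then have "finite J"
    by (meson finite_lessThan finite_subset lessThan_iff subsetI)
  define c where "c = Min J"
  define d where "d = Max J"
  have cd: "c \<in> J" "d \<in> J" "\<And>j. j \<in> J \<Longrightarrow> c \<le> j \<and> j \<le> d"
    using \<open>finite J\<close> \<open>J \<noteq> {}\<close> by (auto simp: c_def d_def)
  have step: "Spine (j - 1) \<in> X \<and> Spine j \<in> X" if j: "c < j" "j \<le> d" for j
  proof -
    have "Spine c \<in> X" "Spine d \<in> X"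
      using cd by (auto simp: J_def I_def)
    \<comment> \<open>Cutting by \<open>spine_index\<close> just before \<open>j\<close> forces the
      spine edge there to lie in \<open>X\<close>.\<close>
    then obtain u v where uv: "u \<in> X" "spine_index u < j" "v \<in> X" "\<not> spine_index v < j" "(u, v) \<in> adj s"
      using connected_cut [OF conn, of "{x \<in> X. spine_index x < j}" "Spine c" "Spine d"] j by auto
    then have "u = Spine (j - 1) \<and> v = Spine j"
      by (cases u; cases v) (auto simp: adj_simps)
    with uv show ?thesis by simp
  qed
  have "J = {c..d}"
  proof
    show "J \<subseteq> {c..d}"
      using cd by auto
    show "{c..d} \<subseteq> J"
    proof
      fix j assume "j \<in> {c..d}"
      then consider "j = c" | "j = d" | "c < j" "j < d"
        by fastforce
      then show "j \<in> J"
      proof cases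
        case 3
        \<comment> \<open>Strictly between \<open>c\<close> and \<open>d\<close>, both spine
          neighbours are present, so \<open>Spine j\<close> is not a leaf.\<close>
        then have "Spine (j - 1) \<in> X" "Spine j \<in> X" "Spine (Suc j) \<in> X"
          using step [of j] step [of "Suc j"] by auto
        moreover have "Suc j < length s"
          using J_len [OF cd(2)] 3 by simp
        ultimately have "{Spine (j - 1), Spine (Suc j)} \<subseteq> nb (Spine j)"
          using 3 by (auto simp: nb_def adj_simps)
        then have "card {Spine (j - 1), Spine (Suc j)} \<le> card (nb (Spine j))"
          by (intro card_mono fin_nb)
        then show ?thesis
          using \<open>Spine j \<in> X\<close> by (simp add: J_def I_iff)
      qed (use cd in auto)
    qed
  qed
  then have I: "I = Spine ` {c..d}"
    by (simp add: IJ)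
  have "L \<subseteq> X"
    by (auto simp: L)
  then have "card X = card L + card I"
    using fin card_mono [of X L] by (simp add: I_def card_Diff_subset finite_subset)
  then have "card X = card L + Suc (d - c)"
    using cd(3) [OF cd(1)] by (simp add: I card_image inj_on_def)
  moreover have "L \<subseteq> outer s c d"
  proof
    fix v assume v: "v \<in> L"
    then obtain y where "y \<in> I" "(y, v) \<in> adj s"
      using leaf_nbr adj_sym by blast
    then have "v \<in> I \<union> outer s c d"
      unfolding I by (auto dest: adj_segment [where c = c and d = d])
    with v show "v \<in> outer s c d"
      by (simp add: I_def)
  qed
  moreover have "c \<le> d" "d < length s"
    using cd(3) [OF cd(1)] J_len [OF cd(2)] by auto
  ultimately show ?thesis
    unfolding L_def by (intro exI [of _ c] exI [of _ d]) simp
qed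

section \<open>The leaf function of a reading caterpillar\<close>

text \<open>The end corrections in \<open>RC_eq_blocks\<close> and in \<open>card_outer\<close> are
  complementary: on the left one applies for \<open>c = 0\<close> and the other for
  \<open>c > 0\<close>, and similarly on the right. Each side thus contributes exactly 1.\<close>

lemma card_outer_RC:
  assumes "c \<le> d" "d < length (RC w)"
  shows "card (outer (RC w) c d) = (\<Sum>j=c..d. blocks w ! j) + 2"
proof -
  note [simp] = RC_eq_blocks [THEN conjunct1]
  have "(\<Sum>j=c..d. RC w ! j) =
      (\<Sum>j=c..d. blocks w ! j + of_bool (j = 0) + of_bool (Suc j = length (blocks w)))"
    using RC_eq_blocks [of w] assms by (intro sum.cong) auto
  also have "\<dots> = (\<Sum>j=c..d. blocks w ! j) + (\<Sum>j=c..d. of_bool (j = 0)) +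
      (\<Sum>j=c..d. of_bool (Suc j = length (blocks w)))"
    by (simp add: sum.distrib)
  also have "(\<Sum>j=c..d. of_bool (j = 0)) = (of_bool (c = 0) :: nat)"
    using assms by (simp add: of_bool_def sum.delta)
  also have "(\<Sum>j=c..d. of_bool (Suc j = length (blocks w))) =
      (\<Sum>j=c..d. of_bool (j = length (blocks w) - 1) :: nat)"
    by (intro sum.cong) (use assms in auto)
  also have "\<dots> = of_bool (Suc d = length (blocks w))"
    using assms by (auto simp: of_bool_def sum.delta)
  finally show ?thesis
    using assms by (auto simp: card_outer)
qed

lemma card_pverts_RC: "card (pverts (caterpillar_graph (RC w))) = length w + 3"
proof -
  define d where "d = length (RC w) - 1"
  have d: "0 \<le> d" "d < length (RC w)" "Suc d = length (blocks w)"
    by (auto simp: d_def RC_eq_blocks)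
  \<comment> \<open>The full spine together with its outer vertices exhausts the graph.\<close>
  have "v \<in> Spine ` {0..d} \<union> outer (RC w) 0 d" if "v \<in> pverts (caterpillar_graph (RC w))" for v
    using that by (cases v) (force simp: pverts_simps outer_def d_def)+
  with segment_tree(1) [OF d(1,2) order_refl]
  have "pverts (caterpillar_graph (RC w)) = Spine ` {0..d} \<union> outer (RC w) 0 d"
    by blast
  then have "card (pverts (caterpillar_graph (RC w))) = Suc d + ((\<Sum>j=0..d. blocks w ! j) + 2)"
    using segment_tree(2) [OF d(1,2) order_refl] card_outer_RC [OF d(1,2)] by simp
  also have "(\<Sum>j=0..d. blocks w ! j) = sum_list (blocks w)"
    by (simp add: sum_list_sum_nth flip: d(3) atLeastLessThanSuc_atLeastAtMost)
  finally show ?thesis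
    using d(3) by (simp add: sum_list_blocks length_blocks length_eq_counts [of w])
qed

text \<open>A segment \<open>c..d\<close> leaves \<open>i + 2 - (d - c)\<close> vertices for the
  leaves, while a factor of length \<open>i\<close> with at most \<open>d - c\<close> zeros has at
  least \<open>i - (d - c)\<close> ones.\<close>

lemma factor_of_tree:
  assumes "X \<subseteq> pverts (caterpillar_graph (RC w))" "undirected_tree (caterpillar (RC w) \<restriction> X)"
    "card X = i + 3"
  shows "\<exists>v. sublist v w \<and> length v = i \<and>
    card (leaves (caterpillar (RC w) \<restriction> X)) \<le> count_list v True + 2"
proof -
  let ?L = "leaves (caterpillar (RC w) \<restriction> X)"
  have "Digraph_Component.connected (caterpillar (RC w) \<restriction> X)" "card X \<ge> 3"
    using assms by (auto simp: undirected_tree_induce)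
  then obtain c d where cd: "c \<le> d" "d < length (RC w)" "card X = card ?L + Suc (d - c)"
    "?L \<subseteq> outer (RC w) c d"
    using tree_segment [OF assms(1)] by blast
  have "card ?L \<le> (\<Sum>j=c..d. blocks w ! j) + 2"
    using card_mono [OF finite_outer cd(4)] card_outer_RC [OF cd(1,2)] by simp
  then have "i \<le> (\<Sum>j=c..d. blocks w ! j) + (d - c)"
    using cd(3) assms(3) by simp
  then obtain v where "sublist v w" "length v = i" "i \<le> count_list v True + (d - c)"
    using factor_of_segment [of c d w i] cd by (auto simp: RC_eq_blocks)
  with cd(3) assms(3) show ?thesis
    by (intro exI [of _ v]) auto
qed

lemma tree_of_factor:
  assumes "sublist v w"
  shows "\<exists>X \<subseteq> pverts (caterpillar_graph (RC w)). undirected_tree (caterpillar (RC w) \<restriction> X) \<and>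
    card X = length v + 3 \<and> count_list v True + 2 \<le> card (leaves (caterpillar (RC w) \<restriction> X))"
proof -
  obtain c d where cd: "c \<le> d" "d < length (RC w)" "d - c = count_list v False"
    "count_list v True \<le> (\<Sum>j=c..d. blocks w ! j)"
    using segment_of_factor [OF assms] by (auto simp: RC_eq_blocks)
  then have "count_list v True + 2 \<le> card (outer (RC w) c d)"
    by (simp add: card_outer_RC)
  \<comment> \<open>Taking exactly this many outer vertices gives, with one spine vertex more than
    \<open>v\<close> has zeros, \<open>length v + 3\<close> vertices in all.\<close>
  then obtain L where L: "L \<subseteq> outer (RC w) c d" "card L = count_list v True + 2"
    by (meson obtain_subset_with_card_n)
  let ?X = "Spine ` {c..d} \<union> L"
  note t = segment_tree [OF cd(1,2) L(1)]
  have "finite (leaves (caterpillar (RC w) \<restriction> ?X))"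
    using finite_subset [OF t(1)] by (simp add: leaves_def)
  then have "card L \<le> card (leaves (caterpillar (RC w) \<restriction> ?X))"
    using t(4) by (rule card_mono)
  with t L cd(3) show ?thesis
    by (intro exI [of _ ?X]) (simp add: length_eq_counts [of v])
qed

section \<open>Comparison of maxima, and subtrees with at most two vertices\<close>

text \<open>Domination in both directions suffices, so trees and factors need not match value by
  value.\<close>

lemma ext_max_shift:
  assumes "finite A" "finite B" "B \<noteq> {}"
    and "\<And>a. a \<in> A \<Longrightarrow> \<exists>b\<in>B. a \<le> b + k" "\<And>b. b \<in> B \<Longrightarrow> \<exists>a\<in>A. b + k \<le> a"
  shows "ext_max A = ext_max B + ereal (real k)"
proof -
  have A: "A \<noteq> {}"
    using assms by blast
  have "Max A = Max B + k"
  proof (rule antisym)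
    obtain b where "b \<in> B" "Max A \<le> b + k"
      using assms(4) [OF Max_in [OF assms(1) A]] by blast
    with Max_ge [OF assms(2)] show "Max A \<le> Max B + k"
      by fastforce
    obtain a where "a \<in> A" "Max B + k \<le> a"
      using assms(5) [OF Max_in [OF assms(2,3)]] by blast
    with Max_ge [OF assms(1)] show "Max B + k \<le> Max A"
      by fastforce
  qed
  with A assms(3) show ?thesis
    by (simp add: ext_max_def)
qed

lemma ext_max_singleton [simp]: "ext_max {n} = ereal (real n)"
  by (simp add: ext_max_def)

lemma F1_finite:
  assumes "i \<le> length w"
  shows "\<exists>n::nat. F1 w i = ereal (real n)"
proof -
  have "sublist (take i w) w \<and> length (take i w) = i"
    using assms by simp
  then show ?thesis
    unfolding F1_def ext_max_def by auto
qed

lemma F1_beyond_length: "i > length w \<Longrightarrow> F1 w i = -\<infinity>"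
  by (auto simp: F1_def ext_max_def dest: sublist_length_le)

lemma card_leaves_small:
  assumes "X \<subseteq> pverts (caterpillar_graph s)" "undirected_tree (caterpillar s \<restriction> X)" "card X \<le> 2"
  shows "card (leaves (caterpillar s \<restriction> X)) = (if card X = 2 then 2 else 0)"
proof -
  have fin: "finite X"
    using assms(1) finite_pverts finite_subset by blast
  have nb: "card {u \<in> X. (v, u) \<in> adj s} \<le> card X - 1" if "v \<in> X" for v
  proof -
    have "{u \<in> X. (v, u) \<in> adj s} \<subseteq> X - {v}"
      using adj_depth by blast
    then have "card {u \<in> X. (v, u) \<in> adj s} \<le> card (X - {v})"
      using fin by (intro card_mono) auto
    with that fin show ?thesis by simp
  qed
  show ?thesis
  proof (cases "card X = 2")
    case True
    then have "Digraph_Component.connected (caterpillar s \<restriction> X)"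
      using assms(2) by (auto simp: undirected_tree_induce)
    then have "card {u \<in> X. (v, u) \<in> adj s} = 1" if "v \<in> X" for v
      using card_nbrs_ge_1 [OF assms(1) _ _ that] nb [OF that] True by auto
    then have "leaves (caterpillar s \<restriction> X) = X"
      by (auto simp: leaves_induce)
    with True show ?thesis by simp
  next
    case False
    then have "leaves (caterpillar s \<restriction> X) = {}"
      using nb assms(3) by (fastforce simp: leaves_induce)
    with False show ?thesis by simp
  qed
qed

text \<open>Ensures that the maximum is not taken over the empty set. A nonempty witness is
  \<open>Spine 0\<close> with at most one outer vertex.\<close>

lemma ex_small_tree:
  assumes "i \<le> 2"
  shows "\<exists>X \<subseteq> pverts (caterpillar_graph (RC w)). undirected_tree (caterpillar (RC w) \<restriction> X) \<and> card X = i"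
proof (cases i)
  case 0
  then show ?thesis
    by (intro exI [of _ "{}"]) (auto simp: undirected_tree_induce)
next
  case (Suc l)
  have c: "0 \<le> (0::nat)" "0 < length (RC w)"
    by (auto simp: RC_eq_blocks)
  have "l \<le> card (outer (RC w) 0 0)"
    using Suc assms card_outer_RC [OF c] by simp
  then obtain L where "L \<subseteq> outer (RC w) 0 0" "card L = l"
    by (meson obtain_subset_with_card_n)
  with segment_tree [OF c] Suc show ?thesis
    by (intro exI [of _ "Spine ` {0..0} \<union> L"]) simp
qed

text \<open>The values up to 2 are the same for all words, so only the length of \<open>w\<close>
  and its values of \<open>F1\<close> matter.\<close>

lemma cat_leaf_function_RC:
  "cat_leaf_function (RC w) i =
     (if length w + 3 < i then None
      else Some (if i < 2 then 0 else if i = 2 then 2 else F1 w (i - 3) + 2))"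
proof (cases "length w + 3 < i")
  case True
  then show ?thesis
    by (simp add: cat_leaf_function_def leaf_function_def card_pverts_RC)
next
  case False
  define A where "A = {card (leaves (caterpillar (RC w) \<restriction> X)) | X.
    X \<subseteq> pverts (caterpillar_graph (RC w)) \<and> card X = i \<and> undirected_tree (caterpillar (RC w) \<restriction> X)}"
  have eq: "cat_leaf_function (RC w) i = Some (ext_max A)"
    using False by (simp add: cat_leaf_function_def leaf_function_def card_pverts_RC A_def)
  show ?thesis
  proof (cases "i \<le> 2")
    case True
    have "A \<subseteq> {if i = 2 then 2 else 0}"
      using card_leaves_small True unfolding A_def by blast
    moreover have "A \<noteq> {}"
      using ex_small_tree [OF True, of w] by (auto simp: A_def)
    ultimately have "A = {if i = 2 then 2 else 0}"
      by blast
    with eq True False show ?thesis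
      by (auto simp: zero_ereal_def)
  next
    case i: False
    define B where "B = {count_list v True | v. sublist v w \<and> length v = i - 3}"
    have "A \<subseteq> (\<lambda>X. card (leaves (caterpillar (RC w) \<restriction> X))) ` Pow (pverts (caterpillar_graph (RC w)))"
      by (auto simp: A_def)
    then have "finite A"
      by (rule finite_subset) simp
    moreover have "finite B"
      by (rule finite_subset [of _ "{..i - 3}"]) (auto simp: B_def length_eq_counts)
    moreover have "sublist (take (i - 3) w) w \<and> length (take (i - 3) w) = i - 3"
      using False i by auto
    then have "B \<noteq> {}"
      unfolding B_def by blast
    moreover have "\<exists>b\<in>B. a \<le> b + 2" if "a \<in> A" for a
    proof -
      from that obtain X where X: "X \<subseteq> pverts (caterpillar_graph (RC w))"
        "undirected_tree (caterpillar (RC w) \<restriction> X)" "card X = i - 3 + 3"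
        "a = card (leaves (caterpillar (RC w) \<restriction> X))"
        using i by (auto simp: A_def)
      with factor_of_tree [OF X(1-3)] show ?thesis
        by (auto simp: B_def)
    qed
    moreover have "\<exists>a\<in>A. b + 2 \<le> a" if "b \<in> B" for b
    proof -
      from that obtain v where v: "sublist v w" "length v + 3 = i" "b = count_list v True"
        using i by (auto simp: B_def)
      with tree_of_factor [OF v(1)] show ?thesis
        by (auto simp: A_def)
    qed
    ultimately have "ext_max A = ext_max B + ereal (real 2)"
      by (rule ext_max_shift)
    then show ?thesis
      using eq i False by (simp add: F1_def B_def)
  qed
qed

theorem theorem2:
  fixes w w' :: "bool list"
  shows "cat_leaf_function (RC w) = cat_leaf_function (RC w') \<longleftrightarrow> (\<forall>i::nat. F1 w i = F1 w' i)"
proof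
  assume eq: "cat_leaf_function (RC w) = cat_leaf_function (RC w')"
  then have "(length w + 3 < i) = (length w' + 3 < i)" for i
    by (drule_tac fun_cong [where x = i]) (auto simp: cat_leaf_function_RC split: if_splits)
  \<comment> \<open>The first arguments at which the two leaf functions are undefined; each gives
    one inequality between the lengths.\<close>
  from this [of "length w + 4"] this [of "length w' + 4"] have len: "length w = length w'"
    by linarith
  show "\<forall>i. F1 w i = F1 w' i"
  proof
    fix i
    show "F1 w i = F1 w' i"
    proof (cases "i \<le> length w")
      case True
      \<comment> \<open>Both values are finite here, so the summand 2 can be cancelled in the
        reals.\<close>
      with len obtain m n where "F1 w i = ereal (real m)" "F1 w' i = ereal (real n)"
        using F1_finite by metis
      moreover have "F1 w i + 2 = F1 w' i + 2"
        using fun_cong [OF eq, of "i + 3"] len True by (simp add: cat_leaf_function_RC)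
      ultimately show ?thesis
        by (simp add: numeral_eq_ereal)
    next
      case False
      with len show ?thesis by (simp add: F1_beyond_length)
    qed
  qed
next
  assume eq: "\<forall>i. F1 w i = F1 w' i"
  \<comment> \<open>\<open>F1\<close> determines the length: it is finite up to the length of the
    word and \<open>-\<infinity>\<close> beyond.\<close>
  have "length u \<le> length v" if "\<forall>i. F1 u i = F1 v i" for u v
  proof (rule ccontr)
    assume "\<not> ?thesis"
    then have "F1 v (length u) = -\<infinity>"
      by (simp add: F1_beyond_length)
    with F1_finite [of "length u" u] that show False
      by auto
  qed
  with eq have "length w = length w'"
    by (metis antisym)
  with eq show "cat_leaf_function (RC w) = cat_leaf_function (RC w')"
    by (simp add: fun_eq_iff cat_leaf_function_RC)
qed

end
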